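(* Let $(\mathbf{A},\cdot,[\cdot,\cdot])$ be a complex unital transposed Poisson algebra. Then $(\mathbf{A},\cdot,[\cdot,\cdot])$ is a generalized Poisson algebra and an algebra of Jordan brackets; that is, $[\cdot,\cdot]$ is both a generalized Poisson bracket and a Jordan bracket on the unital commutative associative algebra $(\mathbf{A},\cdot)$.
   Context: A transposed Poisson algebra is a triple $(\mathbf{A},\cdot,[\cdot,\cdot])$ consisting of a vector space with two nonzero bilinear operations such that $(\mathbf{A},\cdot)$ is a commutative associative algebra, $(\mathbf{A},[\cdot,\cdot])$ is a Lie algebra, and $2z\cdot[x,y]=[z\cdot x,y]+[x,z\cdot y]$ for all $x,y,z$. It is unital if $(\mathbf{A},\cdot)$ has an identity element $1$. Let $(\mathbf{A},\cdot)$ be a unital commutative associative algebra and $\{\cdot,\cdot\}$ an anticommutative bilinear product on $\mathbf{A}$. It is a generalized Poisson bracket if $(\mathbf{A},\{\cdot,\cdot\})$ is a Lie algebra and $$\{x,y\cdot z\}=\{x,y\}\cdot z+y\cdot\{x,z\}-\{x,1\}\cdot y\cdot z .$$ It is a Jordan bracket if $$\{x,y\cdot z\}=\{x,y\}\cdot z+y\cdot\{x,z\}-\{x,1\}\cdot y\cdot z,$$ $$\{x,\{y,z\}\}+\{y,\{z,x\}\}+\{z,\{x,y\}\}=\{x,1\}\cdot\{y,z\}+\{y,1\}\cdot\{z,x\}+\{z,1\}\cdot\{x,y\}.$$ *)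

theory Defs
  imports Complex_Main
begin

locale bilinear_product = vector_space scale
  for scale :: "'k::field \<Rightarrow> 'a::ab_group_add \<Rightarrow> 'a" (infixr \<open>*s\<close> 75) +
  fixes prd :: "'a \<Rightarrow> 'a \<Rightarrow> 'a"
  assumes linear_left: "Vector_Spaces.linear scale scale (\<lambda>x. prd x y)"
    and linear_right: "Vector_Spaces.linear scale scale (\<lambda>y. prd x y)"

locale comm_assoc_algebra = bilinear_product scale mul + abel_semigroup mul
  for scale :: "'k::field \<Rightarrow> 'a::ab_group_add \<Rightarrow> 'a" (infixr \<open>*s\<close> 75)
    and mul :: "'a \<Rightarrow> 'a \<Rightarrow> 'a" (infixl \<open>\<cdot>\<close> 70)

locale unital_comm_assoc_algebra = comm_assoc_algebra scale mul + comm_monoid mul e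
  for scale :: "'k::field \<Rightarrow> 'a::ab_group_add \<Rightarrow> 'a" (infixr \<open>*s\<close> 75)
    and mul :: "'a \<Rightarrow> 'a \<Rightarrow> 'a" (infixl \<open>\<cdot>\<close> 70)
    and e :: 'a

locale lie_algebra = bilinear_product scale br
  for scale :: "'k::field \<Rightarrow> 'a::ab_group_add \<Rightarrow> 'a" (infixr \<open>*s\<close> 75)
    and br :: "'a \<Rightarrow> 'a \<Rightarrow> 'a" +
  assumes alternating: "br x x = 0"
    and jacobi: "br x (br y z) + br y (br z x) + br z (br x y) = 0"

locale transposed_poisson_algebra = comm_assoc_algebra scale mul + lie: lie_algebra scale br
  for scale :: "'k::field \<Rightarrow> 'a::ab_group_add \<Rightarrow> 'a" (infixr \<open>*s\<close> 75)
    and mul :: "'a \<Rightarrow> 'a \<Rightarrow> 'a" (infixl \<open>\<cdot>\<close> 70)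
    and br :: "'a \<Rightarrow> 'a \<Rightarrow> 'a" +
  assumes mul_nonzero: "\<exists>x y. x \<cdot> y \<noteq> 0"
    and br_nonzero: "\<exists>x y. br x y \<noteq> 0"
    and transposed_leibniz: "2 *s (z \<cdot> br x y) = br (z \<cdot> x) y + br x (z \<cdot> y)"

locale unital_transposed_poisson_algebra =
  transposed_poisson_algebra scale mul br + unital_comm_assoc_algebra scale mul e
  for scale :: "'k::field \<Rightarrow> 'a::ab_group_add \<Rightarrow> 'a" (infixr \<open>*s\<close> 75)
    and mul :: "'a \<Rightarrow> 'a \<Rightarrow> 'a" (infixl \<open>\<cdot>\<close> 70)
    and br :: "'a \<Rightarrow> 'a \<Rightarrow> 'a"
    and e :: 'a

locale anticommutative_product_on_algebra =
  unital_comm_assoc_algebra scale mul e + br: bilinear_product scale br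
  for scale :: "'k::field \<Rightarrow> 'a::ab_group_add \<Rightarrow> 'a" (infixr \<open>*s\<close> 75)
    and mul :: "'a \<Rightarrow> 'a \<Rightarrow> 'a" (infixl \<open>\<cdot>\<close> 70)
    and e :: 'a
    and br :: "'a \<Rightarrow> 'a \<Rightarrow> 'a" +
  assumes anticommutative: "br x y = - br y x"

locale generalized_poisson_bracket =
  anticommutative_product_on_algebra scale mul e br + lie: lie_algebra scale br
  for scale :: "'k::field \<Rightarrow> 'a::ab_group_add \<Rightarrow> 'a" (infixr \<open>*s\<close> 75)
    and mul :: "'a \<Rightarrow> 'a \<Rightarrow> 'a" (infixl \<open>\<cdot>\<close> 70)
    and e :: 'a
    and br :: "'a \<Rightarrow> 'a \<Rightarrow> 'a" +
  assumes generalized_leibniz: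
    "br x (y \<cdot> z) = br x y \<cdot> z + y \<cdot> br x z - br x e \<cdot> y \<cdot> z"

locale jordan_bracket = anticommutative_product_on_algebra scale mul e br
  for scale :: "'k::field \<Rightarrow> 'a::ab_group_add \<Rightarrow> 'a" (infixr \<open>*s\<close> 75)
    and mul :: "'a \<Rightarrow> 'a \<Rightarrow> 'a" (infixl \<open>\<cdot>\<close> 70)
    and e :: 'a
    and br :: "'a \<Rightarrow> 'a \<Rightarrow> 'a" +
  assumes generalized_leibniz:
    "br x (y \<cdot> z) = br x y \<cdot> z + y \<cdot> br x z - br x e \<cdot> y \<cdot> z"
    and generalized_jacobi:
    "br x (br y z) + br y (br z x) + br z (br x y)
     = br x e \<cdot> br y z + br y e \<cdot> br z x + br z e \<cdot> br x y"

end

theory Submission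
  imports Defs
begin

text \<open>
  Put \<open>D x = [1, x]\<close>. The transposed Leibniz rule at the unit reads
  \<open>2 z D y = [z, y] + D (z y)\<close>. Its parts symmetric and antisymmetric in \<open>y\<close> and \<open>z\<close>
  say that \<open>D\<close> is a derivation and that \<open>[z, y] = z D y - y D z\<close>. Both generalized
  Leibniz rules are then immediate, and in the generalized Jacobi identity both sides vanish.
\<close>

context bilinear_product
begin

lemma prd_add_left: "prd (x + y) z = prd x z + prd y z"
  and prd_diff_left: "prd (x - y) z = prd x z - prd y z"
  and prd_minus_left: "prd (- x) z = - prd x z"
proof -
  interpret Vector_Spaces.linear scale scale "\<lambda>x. prd x z"
    by (rule linear_left)
  show "prd (x + y) z = prd x z + prd y z" "prd (x - y) z = prd x z - prd y z"
    "prd (- x) z = - prd x z"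
    by (rule add diff neg)+
qed

lemma prd_add_right: "prd z (x + y) = prd z x + prd z y"
  and prd_diff_right: "prd z (x - y) = prd z x - prd z y"
  and prd_minus_right: "prd z (- x) = - prd z x"
proof -
  interpret Vector_Spaces.linear scale scale "\<lambda>x. prd z x"
    by (rule linear_right)
  show "prd z (x + y) = prd z x + prd z y" "prd z (x - y) = prd z x - prd z y"
    "prd z (- x) = - prd z x"
    by (rule add diff neg)+
qed

lemmas prd_distribs = prd_add_left prd_diff_left prd_minus_left
  prd_add_right prd_diff_right prd_minus_right

end

lemma (in lie_algebra) br_anticommute: "br x y = - br y x"
proof -
  have "br x y + br y x = 0"
    using alternating[of "x + y", unfolded prd_add_left prd_add_right]
    by (simp add: alternating add.commute)
  then show ?thesis
    by (rule eq_neg_iff_add_eq_0[THEN iffD2])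
qed

context unital_transposed_poisson_algebra
begin

lemma scale_two: "2 *s x = x + x"
  using scale_left_distrib[of 1 1 x] by simp

lemma transposed_leibniz_unit: "2 *s (x \<cdot> br e y) = br x y + br e (x \<cdot> y)"
  using transposed_leibniz[of x e y] by simp

text \<open>Add the unit rule to its copy with \<open>x\<close> and \<open>y\<close> exchanged:
  \<open>br x y\<close> and \<open>br y x\<close> cancel, and the two \<open>br e\<close> terms
  agree by commutativity. The field is still arbitrary here, so dividing by 2 requires
  \<open>2 \<noteq> 0\<close>.\<close>

lemma br_unit_derivation:
  assumes "(2::'k) \<noteq> 0"
  shows "br e (x \<cdot> y) = x \<cdot> br e y + y \<cdot> br e x"
proof -
  have "2 *s (x \<cdot> br e y + y \<cdot> br e x) = br e (x \<cdot> y) + br e (x \<cdot> y)"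
    using lie.br_anticommute[of x y]
    by (simp add: scale_right_distrib transposed_leibniz_unit commute[of y x])
  also have "\<dots> = 2 *s br e (x \<cdot> y)"
    by (rule scale_two[symmetric])
  finally show ?thesis
    by (rule scale_left_imp_eq[OF assms, symmetric])
qed

text \<open>Subtracting the two copies instead cancels the \<open>br e\<close> terms and doubles the
  bracket.\<close>

lemma br_eq_wronskian:
  assumes "(2::'k) \<noteq> 0"
  shows "br x y = x \<cdot> br e y - y \<cdot> br e x"
proof -
  have "2 *s (x \<cdot> br e y - y \<cdot> br e x) = br x y + br x y"
    using lie.br_anticommute[of y x]
    by (simp add: scale_right_diff_distrib transposed_leibniz_unit commute[of y x])
  also have "\<dots> = 2 *s br x y"
    by (rule scale_two[symmetric])
  finally show ?thesis
    by (rule scale_left_imp_eq[OF assms, symmetric])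
qed

text \<open>With \<open>D = br e\<close>, the two Wronskians on the right contribute
  \<open>- y z D x\<close> twice. As \<open>br x e = - D x\<close>, the last term restores one copy,
  leaving \<open>x D (y z) - y z D x\<close>.\<close>

lemma br_generalized_leibniz:
  assumes "(2::'k) \<noteq> 0"
  shows "br x (y \<cdot> z) = br x y \<cdot> z + y \<cdot> br x z - br x e \<cdot> y \<cdot> z"
  using lie.br_anticommute[of x e]
  by (simp add: br_eq_wronskian[OF assms, of x y] br_eq_wronskian[OF assms, of x z]
      br_eq_wronskian[OF assms, of x "y \<cdot> z"] br_unit_derivation[OF assms] prd_distribs ac_simps)

text \<open>Up to sign, the sum expands a 3 by 3 determinant with rows
  \<open>(D x, D y, D z)\<close>, \<open>(x, y, z)\<close> and \<open>(D x, D y, D z)\<close>, where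
  \<open>D = br e\<close>; two rows coincide.\<close>

lemma br_unit_cyclic_sum:
  assumes "(2::'k) \<noteq> 0"
  shows "br x e \<cdot> br y z + br y e \<cdot> br z x + br z e \<cdot> br x y = 0"
  using lie.br_anticommute[of x e] lie.br_anticommute[of y e] lie.br_anticommute[of z e]
  by (simp add: br_eq_wronskian[OF assms, of x y] br_eq_wronskian[OF assms, of y z]
      br_eq_wronskian[OF assms, of z x] prd_distribs ac_simps)

lemma generalized_poisson_bracket:
  assumes "(2::'k) \<noteq> 0"
  shows "generalized_poisson_bracket scale mul e br"
  by unfold_locales (rule lie.br_anticommute br_generalized_leibniz[OF assms])+

lemma jordan_bracket:
  assumes "(2::'k) \<noteq> 0"
  shows "jordan_bracket scale mul e br"
  by unfold_locales
    \<comment> \<open>In the generalized Jacobi identity the left side is 0 by the Lie identity and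
      the right side by the cyclic sum.\<close>
    (simp_all only: lie.br_anticommute[symmetric] br_generalized_leibniz[OF assms] lie.jacobi
      br_unit_cyclic_sum[OF assms])

end

theorem corollary24:
  fixes scale :: "complex \<Rightarrow> 'a::ab_group_add \<Rightarrow> 'a"
    and mul br :: "'a \<Rightarrow> 'a \<Rightarrow> 'a"
    and e :: 'a
  assumes "unital_transposed_poisson_algebra scale mul br e"
  shows "generalized_poisson_bracket scale mul e br \<and> jordan_bracket scale mul e br"
proof -
  interpret unital_transposed_poisson_algebra scale mul br e
    by (rule assms)
  show ?thesis
    \<comment> \<open>Over the complex numbers the premise \<open>2 \<noteq> 0\<close>
      holds.\<close>
    using generalized_poisson_bracket jordan_bracket by simp
qed

end
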